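(* Let $M>0$, let $(\gamma_m)_{m\ge 2}$ and $(\delta_m)_{m\ge2}$ be real sequences with $\gamma_m,\delta_m\ge \alpha_2:=\min\{\gamma_2,\delta_2\}>0$ for all $m\ge 2$, and let $f(z)=z+\sum_{m=2}^{\infty}a_m z^m+\overline{\sum_{m=2}^{\infty}b_m z^m}$ belong to $\mathcal{S}^0_{h+\bar g}(M)$. Then $$r-\frac{M}{\alpha_2}r^2\le |f(z)|\le r+\frac{M}{\alpha_2}r^2\qquad (|z|=r<1).$$ The inequalities are sharp for the functions $f(z)=z\pm\frac{M}{\alpha_2}z^2$ and $f(z)=z\pm\frac{M}{\alpha_2}\bar z^2$: for each of these functions that belongs to $\mathcal{S}^0_{h+\bar g}(M)$, and for every $r\in(0,1)$, each of the two bounds is attained at some point $z$ with $|z|=r$.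
   Context: $\mathbb{D}=\{z\in\mathbb{C}:|z|<1\}$. $\mathcal{H}_0$ is the class of complex-valued harmonic functions $f=h+\bar g$ on $\mathbb{D}$ with $h(z)=z+\sum_{m=2}^\infty a_mz^m$ and $g(z)=\sum_{m=2}^\infty b_mz^m$ analytic in $\mathbb{D}$. Such an $f$ is sense-preserving if its Jacobian $|h'|^2-|g'|^2$ is positive on $\mathbb{D}$. For fixed sequences $(\gamma_m),(\delta_m)$ as in the claim, $\mathcal{S}^0_{h+\bar g}(M)$ is the class of sense-preserving $f=h+\bar g\in\mathcal{H}_0$ with $\sum_{m=2}^\infty(\gamma_m|a_m|+\delta_m|b_m|)\le M$. *)

theory Defs
  imports "HOL-Complex_Analysis.Complex_Analysis"
begin

abbreviation unit_disc :: "complex set" where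
  "unit_disc \<equiv> ball 0 1"

text \<open>
  Harmonicity of \<open>f\<close> is not a separate requirement: it is built into the decomposition
  into an analytic and an anti-analytic part. Only the values of \<open>f\<close>, \<open>h\<close>, \<open>g\<close> on the disc and
  the coefficients \<open>a m\<close>, \<open>b m\<close> with \<open>m \<ge> 2\<close> matter. On the disc, \<open>f\<close> determines \<open>h\<close> and \<open>g\<close>
  (because \<open>h 0 = g 0 = 0\<close>), and hence these coefficients, so existential quantification
  over them below is harmless.
\<close>

definition H0_decomposition ::
  "(complex \<Rightarrow> complex) \<Rightarrow> (complex \<Rightarrow> complex) \<Rightarrow> (complex \<Rightarrow> complex)
    \<Rightarrow> (nat \<Rightarrow> complex) \<Rightarrow> (nat \<Rightarrow> complex) \<Rightarrow> bool" where
  "H0_decomposition f h g a b \<longleftrightarrow>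
     h analytic_on unit_disc \<and> g analytic_on unit_disc \<and>
     (\<forall>z\<in>unit_disc. f z = h z + cnj (g z)) \<and>
     (\<forall>z\<in>unit_disc. (\<lambda>m. a (m + 2) * z ^ (m + 2)) sums (h z - z)) \<and>
     (\<forall>z\<in>unit_disc. (\<lambda>m. b (m + 2) * z ^ (m + 2)) sums g z)"

definition harmonic_jacobian ::
  "(complex \<Rightarrow> complex) \<Rightarrow> (complex \<Rightarrow> complex) \<Rightarrow> complex \<Rightarrow> real" where
  "harmonic_jacobian h g z = (cmod (deriv h z))\<^sup>2 - (cmod (deriv g z))\<^sup>2"

definition sense_preserving :: "(complex \<Rightarrow> complex) \<Rightarrow> (complex \<Rightarrow> complex) \<Rightarrow> bool" where
  "sense_preserving h g \<longleftrightarrow> (\<forall>z\<in>unit_disc. harmonic_jacobian h g z > 0)"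

text \<open>
  For the nonnegative weights of interest, summability expresses that the series has a finite
  value; without it \<open>suminf\<close> would be unspecified.
\<close>

definition S0_class ::
  "(nat \<Rightarrow> real) \<Rightarrow> (nat \<Rightarrow> real) \<Rightarrow> real \<Rightarrow> (complex \<Rightarrow> complex) set" where
  "S0_class \<gamma> \<delta> M =
     {f. \<exists>h g a b. H0_decomposition f h g a b \<and> sense_preserving h g \<and>
           summable (\<lambda>m. \<gamma> (m + 2) * cmod (a (m + 2)) + \<delta> (m + 2) * cmod (b (m + 2))) \<and>
           (\<Sum>m. \<gamma> (m + 2) * cmod (a (m + 2)) + \<delta> (m + 2) * cmod (b (m + 2))) \<le> M}"

end

theory Submission
  imports Defs
begin

text \<open>
  Since \<open>\<gamma>\<^sub>m, \<delta>\<^sub>m \<ge> \<alpha>\<^sub>2\<close> and \<open>r\<^sup>m \<le> r\<^sup>2\<close>, the weighted coefficient bound gives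
  \<open>\<bar>f(z) - z\<bar> \<le> (M / \<alpha>\<^sub>2) r\<^sup>2\<close>, hence both estimates. For the four extremal functions, with
  \<open>c = M / \<alpha>\<^sub>2\<close>, the bounds are attained at \<open>z = r\<close> and \<open>z = -r\<close>, provided that \<open>c r \<le> 1\<close>.
  That holds because a sense-preserving \<open>z + p z\<^sup>2 + cnj (q z\<^sup>2)\<close> satisfies
  \<open>\<bar>p\<bar> + \<bar>q\<bar> \<le> 1/2\<close>: otherwise its Jacobian vanishes at some point of modulus
  \<open>1 / (2 (\<bar>p\<bar> + \<bar>q\<bar>)) < 1\<close>.
\<close>

text \<open>Evaluation at \<open>1\<close> and \<open>\<i>\<close> yields \<open>A + cnj B\<close>
  and \<open>\<i> * (A - cnj B)\<close>, which together determine \<open>A\<close> and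
  \<open>B\<close>.\<close>

lemma complex_real_linear_unique:
  fixes A B C D :: complex
  assumes "(\<lambda>v. A * v + cnj (B * v)) = (\<lambda>v. C * v + cnj (D * v))"
  shows "A = C" "B = D"
proof -
  have "A + cnj B = C + cnj D" "A * \<i> + cnj (B * \<i>) = C * \<i> + cnj (D * \<i>)"
    using fun_cong[OF assms, of 1] fun_cong[OF assms, of \<i>] by simp_all
  then show "A = C" "B = D"
    by (simp_all add: complex_eq_iff)
qed

text \<open>\<open>S0_class\<close> hides \<open>h\<close> and \<open>g\<close> behind existential
  quantifiers. Their derivatives can still be read off from \<open>f\<close>, because the real
  derivative of \<open>h + cnj g\<close> is \<open>v\<close> mapped to
  \<open>h' v + cnj (g' v)\<close> and real derivatives are unique. No coefficient comparison is
  needed.\<close>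

lemma H0_decomposition_deriv:
  assumes dec: "H0_decomposition f h g a b" and z: "z \<in> unit_disc"
    and f': "(f has_derivative (\<lambda>v. A * v + cnj (B * v))) (at z)"
  shows "deriv h z = A" "deriv g z = B"
proof -
  have an: "h analytic_on unit_disc" "g analytic_on unit_disc"
    and eq: "\<And>w. w \<in> unit_disc \<Longrightarrow> f w = h w + cnj (g w)"
    using dec by (auto simp: H0_decomposition_def)
  have "(h has_field_derivative deriv h z) (at z)" "(g has_field_derivative deriv g z) (at z)"
    using an z by (metis DERIV_deriv_iff_field_differentiable analytic_on_imp_differentiable_at)+
  then have "((\<lambda>w. h w + cnj (g w)) has_derivative (\<lambda>v. deriv h z * v + cnj (deriv g z * v))) (at z)"
    unfolding has_field_derivative_def
    by (intro has_derivative_add bounded_linear.has_derivative[OF bounded_linear_cnj])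
  then have "(f has_derivative (\<lambda>v. deriv h z * v + cnj (deriv g z * v))) (at z)"
    by (rule has_derivative_transform_within_open[OF _ open_ball z]) (simp add: eq)
  from complex_real_linear_unique[OF has_derivative_unique[OF this f']]
  show "deriv h z = A" "deriv g z = B" .
qed

lemma sense_preserving_quadratic_bound:
  assumes dec: "H0_decomposition (\<lambda>z. z + p * z\<^sup>2 + cnj (q * z\<^sup>2)) h g a b"
    and sp: "sense_preserving h g"
  shows "cmod p + cmod q \<le> 1 / 2"
proof (rule ccontr)
  define s where "s = cmod p + cmod q"
  assume "\<not> ?thesis"
  then have s: "s > 1 / 2" by (simp add: s_def)
  \<comment> \<open>\<open>u\<close> rotates \<open>p\<close> onto the nonnegative real axis;
    \<open>p = 0\<close> is separate since \<open>sgn 0\<close> is not unimodular.\<close>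
  obtain u where u: "cmod u = 1" "p * u = cmod p"
  proof (cases "p = 0")
    case True
    with that[of 1] show ?thesis by simp
  next
    case False
    with that[of "cnj (sgn p)"] show ?thesis
      by (simp add: sgn_div_norm norm_divide scaleR_conv_of_real complex_norm_square[symmetric]
          norm_mult power2_eq_square field_simps flip: of_real_mult)
  qed
  \<comment> \<open>The direction makes \<open>p * z\<close> real and nonpositive, and the modulus
    is chosen so that \<open>1 + 2 * p * z\<close> drops to
    \<open>1 - cmod p / s = cmod q / s\<close>, which is also the modulus of
    \<open>2 * q * z\<close>.\<close>
  define z where "z = - (u / (2 * s))"
  have nz: "cmod z = 1 / (2 * s)"
    using s by (simp add: z_def norm_divide norm_mult u)
  then have z: "z \<in> unit_disc" using s by simp
  have "((\<lambda>z. z + p * z\<^sup>2 + cnj (q * z\<^sup>2)) has_derivative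
      (\<lambda>v. (1 + 2 * p * z) * v + cnj (2 * q * z * v))) (at z)"
    by (auto intro!: derivative_eq_intros bounded_linear.has_derivative[OF bounded_linear_cnj]
        simp: algebra_simps)
  from H0_decomposition_deriv[OF dec z this]
  have d: "deriv h z = 1 + 2 * p * z" "deriv g z = 2 * q * z" .
  have "1 + 2 * p * z = 1 - complex_of_real (cmod p / s)"
    using s u(2) by (simp add: z_def field_simps)
  also have "\<dots> = complex_of_real (cmod q / s)"
    using s by (simp add: s_def field_simps flip: of_real_add)
  finally have "cmod (deriv h z) = cmod q / s"
    using s d by (simp add: norm_divide)
  moreover have "cmod (deriv g z) = cmod q / s"
    by (simp add: d norm_mult nz)
  ultimately have "harmonic_jacobian h g z = 0"
    by (simp add: harmonic_jacobian_def)
  then show False using sp z by (force simp: sense_preserving_def)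
qed

lemma S0_class_dist_bound:
  assumes f: "f \<in> S0_class \<gamma> \<delta> M" and z: "cmod z < 1" and \<alpha>: "\<alpha> > 0"
    and \<gamma>: "\<And>m. m \<ge> 2 \<Longrightarrow> \<gamma> m \<ge> \<alpha>" and \<delta>: "\<And>m. m \<ge> 2 \<Longrightarrow> \<delta> m \<ge> \<alpha>"
  shows "cmod (f z - z) \<le> M / \<alpha> * (cmod z)\<^sup>2"
proof -
  obtain h g a b where dec: "H0_decomposition f h g a b"
    and sm: "summable (\<lambda>m. \<gamma> (m + 2) * cmod (a (m + 2)) + \<delta> (m + 2) * cmod (b (m + 2)))"
      (is "summable ?w")
    and le: "(\<Sum>m. \<gamma> (m + 2) * cmod (a (m + 2)) + \<delta> (m + 2) * cmod (b (m + 2))) \<le> M"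
    using f by (auto simp: S0_class_def)
  let ?t = "\<lambda>m. a (m + 2) * z ^ (m + 2) + cnj (b (m + 2) * z ^ (m + 2))"
  have zd: "z \<in> unit_disc" using z by simp
  have "(\<lambda>m. a (m + 2) * z ^ (m + 2)) sums (h z - z)"
    "(\<lambda>m. b (m + 2) * z ^ (m + 2)) sums g z"
    and fz: "f z = h z + cnj (g z)"
    using dec zd unfolding H0_decomposition_def by blast+
  then have "?t sums (h z - z + cnj (g z))"
    by (intro sums_add) (auto simp only: sums_cnj)
  then have t: "?t sums (f z - z)"
    by (simp add: fz algebra_simps)
  \<comment> \<open>The shifted exponent \<open>m + 2\<close> is at least 2, so
    \<open>(cmod z)\<^sup>2\<close> factors out of every term; the factor
    \<open>1 / \<alpha>\<close> pays for replacing \<open>\<alpha>\<close> by the weights.\<close>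
  have bd: "cmod (?t m) \<le> (cmod z)\<^sup>2 / \<alpha> * ?w m" for m
  proof -
    have "cmod (?t m) \<le> (cmod (a (m + 2)) + cmod (b (m + 2))) * cmod z ^ (m + 2)"
      by (rule order_trans[OF norm_triangle_ineq]) (simp add: norm_mult norm_power algebra_simps)
    also have "\<dots> \<le> (cmod (a (m + 2)) + cmod (b (m + 2))) * (cmod z)\<^sup>2"
      using z by (intro mult_left_mono power_decreasing) auto
    also have "\<dots> = (cmod z)\<^sup>2 / \<alpha> * (\<alpha> * cmod (a (m + 2)) + \<alpha> * cmod (b (m + 2)))"
      using \<alpha> by (simp add: field_simps)
    also have "\<dots> \<le> (cmod z)\<^sup>2 / \<alpha> * ?w m"
      using \<alpha> by (intro mult_left_mono add_mono mult_right_mono \<gamma> \<delta>) auto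
    finally show ?thesis .
  qed
  have sm': "summable (\<lambda>m. (cmod z)\<^sup>2 / \<alpha> * ?w m)"
    using sm by (rule summable_mult)
  have "cmod (f z - z) = cmod (\<Sum>m. ?t m)"
    using t by (simp only: sums_iff)
  also have "\<dots> \<le> (\<Sum>m. (cmod z)\<^sup>2 / \<alpha> * ?w m)"
    using bd by (intro norm_suminf_le sm')
  also have "\<dots> = (cmod z)\<^sup>2 / \<alpha> * (\<Sum>m. ?w m)"
    using sm by (rule suminf_mult)
  also have "\<dots> \<le> (cmod z)\<^sup>2 / \<alpha> * M"
    using le \<alpha> by (intro mult_left_mono) auto
  finally show ?thesis by (simp add: mult.commute)
qed

text \<open>On the real axis \<open>F\<close> reduces to \<open>x + e * c * x\<^sup>2\<close>, so
  the sign \<open>e\<close> decides which of the points \<open>r\<close> and \<open>-r\<close>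
  attains which bound.\<close>

lemma quadratic_S0_class_attains:
  fixes c e r :: real
  assumes F: "F \<in> S0_class \<gamma> \<delta> M"
    and form: "F = (\<lambda>z. z + p * z\<^sup>2 + cnj (q * z\<^sup>2))"
    and c: "cmod p + cmod q = c" and pq: "p + cnj q = of_real (e * c)" and e: "\<bar>e\<bar> = 1"
    and r: "0 < r" "r < 1"
  shows "(\<exists>z. cmod z = r \<and> cmod (F z) = r - c * r\<^sup>2) \<and> (\<exists>z. cmod z = r \<and> cmod (F z) = r + c * r\<^sup>2)"
proof -
  have c0: "c \<ge> 0" using c by (metis add_nonneg_nonneg norm_ge_zero)
  have "c \<le> 1 / 2"
    using F sense_preserving_quadratic_bound c unfolding S0_class_def form by blast
  then have "c * r \<le> 1 * 1"
    using r by (intro mult_mono) auto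
  \<comment> \<open>This makes the lower bound nonnegative, so that it can be a modulus.\<close>
  then have cr: "c * r\<^sup>2 \<le> r"
    using r mult_right_mono[of "c * r" 1 r] by (simp add: power2_eq_square mult.assoc)
  have F_real: "F (of_real x) = of_real (x + e * c * x\<^sup>2)" for x
  proof -
    have "F (of_real x) = of_real x + (p + cnj q) * of_real (x\<^sup>2)"
      by (simp add: form algebra_simps)
    then show ?thesis by (simp add: pq)
  qed
  have e2: "e = 1 \<or> e = - 1" using e by arith
  then have "cmod (F (of_real (- (e * r)))) = r - c * r\<^sup>2"
    unfolding F_real norm_of_real using cr r by auto
  moreover have "cmod (F (of_real (e * r))) = r + c * r\<^sup>2"
    unfolding F_real norm_of_real using e2 r mult_nonneg_nonneg[OF c0 zero_le_power2[of r]] by auto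
  moreover have "cmod (of_real (e * r)) = r" "cmod (of_real (- (e * r))) = r"
    unfolding norm_of_real using e r by (simp_all add: abs_mult)
  ultimately show ?thesis by blast
qed

theorem theorem2p1:
  fixes M \<alpha>2 :: real and \<gamma> \<delta> :: "nat \<Rightarrow> real"
  assumes "M > 0"
    and "\<alpha>2 = min (\<gamma> 2) (\<delta> 2)"
    and "\<alpha>2 > 0"
    and "\<And>m. m \<ge> 2 \<Longrightarrow> \<gamma> m \<ge> \<alpha>2"
    and "\<And>m. m \<ge> 2 \<Longrightarrow> \<delta> m \<ge> \<alpha>2"
  shows "(\<forall>f\<in>S0_class \<gamma> \<delta> M. \<forall>z r. cmod z = r \<and> r < 1 \<longrightarrow>
            r - M / \<alpha>2 * r\<^sup>2 \<le> cmod (f z) \<and> cmod (f z) \<le> r + M / \<alpha>2 * r\<^sup>2) \<and>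
         (\<forall>F\<in>{\<lambda>z. z + complex_of_real (M / \<alpha>2) * z\<^sup>2,
               \<lambda>z. z - complex_of_real (M / \<alpha>2) * z\<^sup>2,
               \<lambda>z. z + complex_of_real (M / \<alpha>2) * (cnj z)\<^sup>2,
               \<lambda>z. z - complex_of_real (M / \<alpha>2) * (cnj z)\<^sup>2}.
            F \<in> S0_class \<gamma> \<delta> M \<longrightarrow>
            (\<forall>r. 0 < r \<and> r < 1 \<longrightarrow>
               (\<exists>z. cmod z = r \<and> cmod (F z) = r - M / \<alpha>2 * r\<^sup>2) \<and>
               (\<exists>z. cmod z = r \<and> cmod (F z) = r + M / \<alpha>2 * r\<^sup>2)))"
proof (intro conjI ballI allI impI; (elim conjE)?)
  fix f z r
  assume f: "f \<in> S0_class \<gamma> \<delta> M" and z: "cmod z = r" "r < 1"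
  have "cmod (f z - z) \<le> M / \<alpha>2 * r\<^sup>2"
    using S0_class_dist_bound[OF f, of z \<alpha>2] assms(3-5) z by simp
  then show "r - M / \<alpha>2 * r\<^sup>2 \<le> cmod (f z)" "cmod (f z) \<le> r + M / \<alpha>2 * r\<^sup>2"
    using norm_triangle_ineq2[of z "z - f z"] norm_triangle_ineq2[of "f z" z] z
    by (simp_all add: norm_minus_commute)
next
  fix F and r :: real
  define c where "c = M / \<alpha>2"
  assume cases: "F \<in> {\<lambda>z. z + complex_of_real (M / \<alpha>2) * z\<^sup>2,
               \<lambda>z. z - complex_of_real (M / \<alpha>2) * z\<^sup>2,
               \<lambda>z. z + complex_of_real (M / \<alpha>2) * (cnj z)\<^sup>2,
               \<lambda>z. z - complex_of_real (M / \<alpha>2) * (cnj z)\<^sup>2}"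
    and F: "F \<in> S0_class \<gamma> \<delta> M" and r: "0 < r" "r < 1"
  have c: "c > 0" using assms by (simp add: c_def)
  \<comment> \<open>The analytic functions take \<open>q = 0\<close>; the other two take
    \<open>p = 0\<close>, since \<open>c * (cnj z)\<^sup>2 = cnj (c * z\<^sup>2)\<close> for real
    \<open>c\<close>.\<close>
  have "\<exists>p q e. F = (\<lambda>z. z + p * z\<^sup>2 + cnj (q * z\<^sup>2)) \<and> cmod p + cmod q = c \<and>
      p + cnj q = of_real (e * c) \<and> \<bar>e\<bar> = (1::real)"
    using cases[folded c_def] unfolding insert_iff empty_iff
  proof (elim disjE)
    assume "F = (\<lambda>z. z + complex_of_real c * z\<^sup>2)"
    then show ?thesis
      using c by (intro exI[of _ "of_real c"] exI[of _ 0] exI[of _ 1]) simp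
  next
    assume "F = (\<lambda>z. z - complex_of_real c * z\<^sup>2)"
    then show ?thesis
      using c by (intro exI[of _ "- of_real c"] exI[of _ 0] exI[of _ "-1"]) simp
  next
    assume "F = (\<lambda>z. z + complex_of_real c * (cnj z)\<^sup>2)"
    then show ?thesis
      using c by (intro exI[of _ 0] exI[of _ "of_real c"] exI[of _ 1]) simp
  next
    assume "F = (\<lambda>z. z - complex_of_real c * (cnj z)\<^sup>2)"
    then show ?thesis
      using c by (intro exI[of _ 0] exI[of _ "- of_real c"] exI[of _ "-1"]) simp
  qed simp
  then obtain p q and e :: real where "F = (\<lambda>z. z + p * z\<^sup>2 + cnj (q * z\<^sup>2))"
    "cmod p + cmod q = c" "p + cnj q = of_real (e * c)" "\<bar>e\<bar> = 1"
    by blast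
  from quadratic_S0_class_attains[OF F this r]
  show "\<exists>z. cmod z = r \<and> cmod (F z) = r - M / \<alpha>2 * r\<^sup>2"
    "\<exists>z. cmod z = r \<and> cmod (F z) = r + M / \<alpha>2 * r\<^sup>2"
    by (simp_all add: c_def)
qed

end
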